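(* For $\mathcal{S}\subset\mathcal{V}$, let $\Gamma_{\mathcal{S}}=\mathrm{diag}(\boldsymbol{\alpha}_{\mathcal{S}})$. The function $\mathcal{S}\mapsto(L_\beta+\Gamma_{\mathcal{S}})^{-1}\in\mathbb{R}^{N\times N}_+$ is nonincreasing and supermodular in $\mathcal{S}$, i.e., the following matrix inequalities hold for any $v,k\in\mathcal{V}\setminus\mathcal{S}$: $$(L_\beta+\Gamma_{\mathcal{S}})^{-1}-(L_\beta+\Gamma_{\mathcal{S}\cup\{v\}})^{-1}\ \ge\ (L_\beta+\Gamma_{\mathcal{S}\cup\{k\}})^{-1}-(L_\beta+\Gamma_{\mathcal{S}\cup\{k,v\}})^{-1}\ \ge\ \mathbf{0}.$$ This result also holds true if $L_\beta$ is replaced with $L_0:=L$ (the case $\boldsymbol{\beta}=\mathbf{0}$).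
   Context: $\mathcal{G}=(\mathcal{V},\mathcal{E})$ is a strongly connected directed graph on $\mathcal{V}=\{1,\dots,N\}$; $W=[w_{ij}]\in\mathbb{R}^{N\times N}$ is a nonnegative matrix such that for $i\ne j$, $w_{ij}>0$ if $(i,j)\in\mathcal{E}$ and $w_{ij}=0$ otherwise, and $w_{ii}>0$ for some $i\in\mathcal{V}$. $\mathbf{1}$ is the all-ones vector and $\mathrm{diag}(\mathbf{x})$ is the diagonal matrix with diagonal $\mathbf{x}$. $L:=\mathrm{diag}(W\mathbf{1})-W$ and $L_\beta:=L+\mathrm{diag}(\boldsymbol{\beta})$ with $\boldsymbol{\beta}\in\mathbb{R}^N_+$. The trust levels $\alpha_i\in[0,\infty]$, $i\in\mathcal{V}$, are fixed; $\boldsymbol{\alpha}_{\mathcal{S}}$ is the vector with $i$-th entry $\alpha_i$ if $i\in\mathcal{S}$ and $0$ otherwise. If some entries of $\boldsymbol{\alpha}_{\mathcal{S}}$ are infinite, $(L_\beta+\Gamma_{\mathcal{S}})^{-1}$ is understood as the limit as these entries tend to $\infty$. Let $\mathcal{V}_\alpha:=\{i\in\mathcal{V}:\alpha_i>0\}$. When $\boldsymbol{\beta}=\mathbf{0}$, the case $\mathcal{S}=\varnothing$ is included with $(L_0+\Gamma_{\varnothing})^{-1}=+\infty$, and every nonempty set $\mathcal{A}$ for which $(L_0+\Gamma_{\mathcal{A}})^{-1}$ appears is assumed to satisfy $\mathcal{A}\cap\mathcal{V}_\alpha\neq\varnothing$. Matrix inequalities are entrywise; $\mathbb{R}^{N\times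 N}_+$ denotes the entrywise nonnegative matrices. *)

theory Defs
  imports "HOL-Analysis.Analysis"
begin

definition strongly_connected :: "('n \<times> 'n) set \<Rightarrow> bool" where
  "strongly_connected E \<longleftrightarrow> (\<forall>i j. (i, j) \<in> E\<^sup>*)"

definition diag_mat :: "real^'n \<Rightarrow> real^'n^'n" where
  "diag_mat x = (\<chi> i j. if i = j then x $ i else 0)"

definition laplacian :: "real^'n^'n \<Rightarrow> real^'n^'n" where
  "laplacian W = diag_mat (W *v (\<chi> i. 1)) - W"

definition restrict_to :: "ennreal^'n \<Rightarrow> 'n set \<Rightarrow> ennreal^'n" where
  "restrict_to \<alpha> S = (\<chi> i. if i \<in> S then \<alpha> $ i else 0)"

text \<open>
  The filter of real vectors whose entries tend jointly to infinity where \<open>a\<close> is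
  infinite, and agree with \<open>a\<close> where \<open>a\<close> is finite.
\<close>

definition approach :: "ennreal^'n \<Rightarrow> (real^'n) filter" where
  "approach a =
     (INF i. if a $ i = \<infinity> then filtercomap (\<lambda>g. g $ i) at_top
             else principal {g. g $ i = enn2real (a $ i)})"

text \<open>
  The inverse of \<open>M + diag a\<close>, as a limit over the infinite entries of \<open>a\<close>. If \<open>a\<close> has
  no infinite entry, this is the ordinary inverse (lemma \<open>ext_inv_finite\<close> below).
  As \<open>Lim\<close> and \<open>matrix_inv\<close> are total, \<open>ext_inv_exists\<close> states that the inverses and
  their limit really exist.
\<close>

definition ext_inv :: "real^'n^'n \<Rightarrow> ennreal^'n \<Rightarrow> real^'n^'n" where
  "ext_inv M a = Lim (approach a) (\<lambda>g. matrix_inv (M + diag_mat g))"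

definition ext_inv_exists :: "real^'n^'n \<Rightarrow> ennreal^'n \<Rightarrow> bool" where
  "ext_inv_exists M a \<longleftrightarrow>
     (\<forall>\<^sub>F g in approach a. invertible (M + diag_mat g)) \<and>
     ((\<lambda>g. matrix_inv (M + diag_mat g)) \<longlongrightarrow> ext_inv M a) (approach a)"

lemma approach_finite:
  assumes "\<And>i. a $ i \<noteq> \<infinity>"
  shows "approach a = principal {\<chi> i. enn2real (a $ i)}"
proof -
  have "approach a = (INF i. principal {g. g $ i = enn2real (a $ i)})"
    unfolding approach_def using assms by simp
  also have "\<dots> = principal (\<Inter>i. {g. g $ i = enn2real (a $ i)})"
    by (rule INF_principal_finite) simp
  also have "(\<Inter>i. {g. g $ i = enn2real (a $ i)}) = {\<chi> i. enn2real (a $ i)}"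
    by (auto simp: vec_eq_iff)
  finally show ?thesis .
qed

lemma ext_inv_finite:
  assumes "\<And>i. a $ i \<noteq> \<infinity>"
  shows "ext_inv M a = matrix_inv (M + diag_mat (\<chi> i. enn2real (a $ i)))"
  unfolding ext_inv_def approach_finite[OF assms]
  by (rule tendsto_Lim) (simp_all add: principal_eq_bot_iff tendsto_def eventually_principal)

lemma approach_neq_bot: "approach a \<noteq> bot"
proof -
  let ?g = "\<lambda>t. \<chi> i. if a $ i = \<infinity> then t else enn2real (a $ i)"
  have "filterlim ?g (approach a) at_top"
    unfolding approach_def filterlim_INF
    by (auto simp: filterlim_filtercomap_iff o_def filterlim_principal filterlim_ident)
  then have *: "filtermap ?g at_top \<le> approach a"
    by (simp add: filterlim_def)
  have "filtermap ?g at_top \<noteq> bot"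
    by (simp add: filtermap_bot_iff)
  then show ?thesis
    using * bot.extremum_uniqueI by fastforce
qed

definition trusting :: "ennreal^'n \<Rightarrow> 'n set" where
  "trusting \<alpha> = {i. \<alpha> $ i > 0}"

definition L\<beta> :: "real^'n^'n \<Rightarrow> real^'n \<Rightarrow> real^'n^'n" where
  "L\<beta> W \<beta> = laplacian W + diag_mat \<beta>"

definition inv\<beta> :: "real^'n^'n \<Rightarrow> real^'n \<Rightarrow> ennreal^'n \<Rightarrow> 'n set \<Rightarrow> real^'n^'n" where
  "inv\<beta> W \<beta> \<alpha> S = ext_inv (L\<beta> W \<beta>) (restrict_to \<alpha> S)"

text \<open>
  For \<open>\<beta> = 0\<close> the matrix is singular at the empty set; its inverse there has all entries
  \<open>+\<infinity>\<close>. The order, zero and difference on \<open>ereal^'n^'n\<close> are entrywise.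
\<close>

definition inv0 :: "real^'n^'n \<Rightarrow> ennreal^'n \<Rightarrow> 'n set \<Rightarrow> ereal^'n^'n" where
  "inv0 W \<alpha> S =
     (\<chi> i j. if S = {} then \<infinity>
              else ereal (ext_inv (laplacian W) (restrict_to \<alpha> S) $ i $ j))"

definition admissible0 :: "ennreal^'n \<Rightarrow> 'n set \<Rightarrow> bool" where
  "admissible0 \<alpha> A \<longleftrightarrow> (A \<noteq> {} \<longrightarrow> A \<inter> trusting \<alpha> \<noteq> {})"

end

theory Submission
  imports Defs
begin

text \<open>
  By the minimum principle, \<open>laplacian W + diag_mat g\<close> is a nonsingular M-matrix for every
  nonzero \<open>g \<ge> 0\<close>, so its inverse \<open>R g\<close> is entrywise nonnegative. The resolvent identity
  \<open>R g - R (g + d) = R g ** diag_mat d ** R (g + d)\<close> shows first that \<open>R\<close> is antitone, and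
  then that its right-hand side, a product of nonnegative factors antitone in \<open>g\<close>, is itself
  nonnegative and antitone in \<open>g\<close>. Monotonicity also gives the limits for infinite trust levels,
  and the inequalities pass to the limit along the path on which all infinite entries equal \<open>t\<close>.
\<close>

section \<open>Entrywise order of matrix products, diagonal matrices and the Laplacian\<close>

lemma matrix_mult_nonneg:
  fixes A :: "real^'m^'n" and B :: "real^'k^'m"
  assumes "0 \<le> A" "0 \<le> B"
  shows "0 \<le> A ** B"
  using assms by (auto simp: less_eq_vec_def matrix_matrix_mult_def intro!: sum_nonneg)

lemma matrix_mult_mono:
  fixes A A' :: "real^'m^'n" and B B' :: "real^'k^'m"
  assumes "A \<le> A'" "B \<le> B'" "0 \<le> A" "0 \<le> B"
  shows "A ** B \<le> A' ** B'"
  unfolding less_eq_vec_def matrix_matrix_mult_def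
proof (clarsimp, intro sum_mono mult_mono)
  fix i j k
  show "A $ i $ k \<le> A' $ i $ k" "B $ k $ j \<le> B' $ k $ j" "0 \<le> B $ k $ j"
    using assms by (auto simp: less_eq_vec_def)
  show "0 \<le> A' $ i $ k"
    using order_trans[OF assms(3) assms(1)] by (auto simp: less_eq_vec_def)
qed

lemma matrix_add_rdistrib:
  fixes A B :: "'a::semiring_1^'m^'n"
  shows "(A + B) ** C = A ** C + B ** C"
  by (simp add: matrix_matrix_mult_def vec_eq_iff distrib_right sum.distrib)

lemma diag_mat_add: "diag_mat (x + y) = diag_mat x + diag_mat y"
  by (simp add: diag_mat_def vec_eq_iff)

lemma diag_mat_zero [simp]: "diag_mat 0 = 0"
  by (simp add: diag_mat_def vec_eq_iff)

lemma diag_mat_nonneg: "0 \<le> d \<Longrightarrow> 0 \<le> diag_mat d"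
  by (simp add: diag_mat_def less_eq_vec_def)

lemma diag_mat_mult_vec: "(diag_mat d *v x) $ i = d $ i * x $ i"
  by (simp add: diag_mat_def matrix_vector_mult_def if_distrib [where f = "\<lambda>y. y * _"] cong: if_cong)

text \<open>The form in differences shows the signs: at an index where \<open>x\<close> is minimal,
  every summand is nonpositive for nonnegative weights.\<close>

lemma laplacian_mult_vec: "(laplacian W *v x) $ i = (\<Sum>j\<in>UNIV. W $ i $ j * (x $ i - x $ j))"
proof -
  have "(laplacian W *v x) $ i = (W *v (\<chi> i. 1)) $ i * x $ i - (W *v x) $ i"
    by (simp add: laplacian_def matrix_vector_mult_diff_rdistrib diag_mat_mult_vec)
  then show ?thesis
    by (simp add: matrix_vector_mult_def sum_distrib_right right_diff_distrib sum_subtractf)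
qed

section \<open>Minimum principle and the inverse for finite diagonals\<close>

text \<open>Strong connectivity in the form used by the minimum principle: paths of positive weight
  between any two indices, without mention of the edge set.\<close>

locale irreducible_nonneg =
  fixes W :: "real^'n^'n"
  assumes nonneg: "W $ i $ j \<ge> 0"
    and irreducible: "(i, j) \<in> {(i, j). W $ i $ j > 0}\<^sup>*"
begin

text \<open>A negative minimum would spread from a minimiser along all positive weights, so
  \<open>x\<close> would be a negative constant; the diagonal \<open>g\<close> would then have to
  vanish.\<close>

lemma minimum_principle:
  assumes g: "0 \<le> g" "g \<noteq> 0" and x: "0 \<le> (laplacian W + diag_mat g) *v x"
  shows "0 \<le> x"
proof (rule ccontr)
  assume "\<not> 0 \<le> x"
  define m where "m = Min (range (($) x))"
  have m_le: "m \<le> x $ i" for i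
    by (simp add: m_def)
  have "m \<in> range (($) x)"
    unfolding m_def by (rule Min_in) auto
  then obtain i0 where i0: "x $ i0 = m"
    by auto
  have "m < 0"
    using \<open>\<not> 0 \<le> x\<close> m_le by (auto simp: less_eq_vec_def not_le intro: le_less_trans)
  \<comment> \<open>At a minimiser the Laplacian part and \<open>g $ i * m\<close> are both
    nonpositive, while their sum is nonnegative. Hence both vanish, and so does each summand of the
    former.\<close>
  have *: "g $ i = 0 \<and> (\<forall>j. W $ i $ j > 0 \<longrightarrow> x $ j = m)" if i: "x $ i = m" for i
  proof -
    have le: "W $ i $ j * (x $ i - x $ j) \<le> 0" for j
      using m_le[of j] nonneg i by (simp add: mult_nonneg_nonpos)
    have "0 \<le> (\<Sum>j\<in>UNIV. W $ i $ j * (x $ i - x $ j)) + g $ i * m"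
      using x i unfolding less_eq_vec_def
      by (metis laplacian_mult_vec diag_mat_mult_vec matrix_vector_mult_add_rdistrib
          vector_add_component zero_index)
    moreover have "(\<Sum>j\<in>UNIV. W $ i $ j * (x $ i - x $ j)) \<le> 0"
      using le by (intro sum_nonpos) auto
    moreover have "g $ i * m \<le> 0"
      using g \<open>m < 0\<close> by (simp add: less_eq_vec_def mult_nonneg_nonpos)
    ultimately have "g $ i * m = 0" and s: "(\<Sum>j\<in>UNIV. W $ i $ j * (x $ i - x $ j)) = 0"
      by linarith+
    moreover have "W $ i $ j = 0 \<or> x $ j = m" for j
      using sum_nonneg_eq_0_iff[of UNIV "\<lambda>j. - (W $ i $ j * (x $ i - x $ j))"] le s i
      by (auto simp: sum_negf)
    ultimately show ?thesis
      using \<open>m < 0\<close> by (metis less_irrefl mult_eq_0_iff)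
  qed
  \<comment> \<open>The set of minimisers contains \<open>i0\<close> and is closed under positive
    weights, so irreducibility makes it everything.\<close>
  have "x $ i = m" for i
    using irreducible[of i0 i] by (induction rule: rtrancl_induct) (use i0 * in auto)
  then have "g = 0"
    using * by (simp add: vec_eq_iff)
  then show False
    using g by simp
qed

text \<open>For a kernel vector \<open>x\<close> the minimum principle applies to both
  \<open>x\<close> and \<open>- x\<close>; a square matrix with trivial kernel is
  invertible.\<close>

lemma invertible_laplacian_add:
  assumes "0 \<le> g" "g \<noteq> 0"
  shows "invertible (laplacian W + diag_mat g)"
proof -
  let ?A = "laplacian W + diag_mat g"
  have "x = 0" if "?A *v x = 0" for x
  proof -
    have "?A *v (- x) = 0"
      using that matrix_vector_mult_diff_distrib[of ?A 0 x] by simp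
    then have "0 \<le> x" "0 \<le> - x"
      using minimum_principle[OF assms, of x] minimum_principle[OF assms, of "- x"] that by simp_all
    then show ?thesis
      by (auto simp: less_eq_vec_def vec_eq_iff intro: order_antisym)
  qed
  then show ?thesis
    unfolding invertible_left_inverse matrix_left_invertible_ker by auto
qed

definition R :: "real^'n \<Rightarrow> real^'n^'n" where
  "R g = matrix_inv (laplacian W + diag_mat g)"

text \<open>\<open>matrix_inv\<close> is a Hilbert choice; invertibility provides the witness that
  makes the chosen matrix a two-sided inverse.\<close>

lemma R_inverse:
  assumes "0 \<le> g" "g \<noteq> 0"
  shows "(laplacian W + diag_mat g) ** R g = mat 1 \<and> R g ** (laplacian W + diag_mat g) = mat 1"
  using invertible_laplacian_add[OF assms] unfolding R_def matrix_inv_def invertible_def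
  by (rule someI_ex)

lemma R_right:
  assumes "0 \<le> g" "g \<noteq> 0"
  shows "(laplacian W + diag_mat g) ** R g = mat 1"
  using R_inverse[OF assms] ..

lemma R_left:
  assumes "0 \<le> g" "g \<noteq> 0"
  shows "R g ** (laplacian W + diag_mat g) = mat 1"
  using R_inverse[OF assms] ..

text \<open>Column \<open>j\<close> of the inverse is mapped to the unit vector at \<open>j\<close>,
  which is nonnegative, so the minimum principle applies to it.\<close>

lemma R_nonneg:
  assumes "0 \<le> g" "g \<noteq> 0"
  shows "0 \<le> R g"
proof -
  have "0 \<le> column j (R g)" for j
  proof (rule minimum_principle[OF assms])
    have "(laplacian W + diag_mat g) *v column j (R g) = column j (mat 1)"
      unfolding R_right[OF assms, symmetric]
      by (simp add: vec_eq_iff column_def matrix_vector_mult_def matrix_matrix_mult_def)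
    then show "0 \<le> (laplacian W + diag_mat g) *v column j (R g)"
      by (simp add: less_eq_vec_def column_def mat_def)
  qed
  then show ?thesis
    by (simp add: less_eq_vec_def column_def)
qed

lemma R_diff:
  assumes "0 \<le> g" "g \<noteq> 0" "0 \<le> g + d" "g + d \<noteq> 0"
  shows "R g - R (g + d) = R g ** diag_mat d ** R (g + d)"
proof -
  let ?A = "laplacian W + diag_mat g"
  \<comment> \<open>The factor inserted on the right is the identity, written as the shifted matrix
    times its inverse; expanding it splits off \<open>R (g + d)\<close>.\<close>
  have "R g = R g ** ((?A + diag_mat d) ** R (g + d))"
    using R_right[OF assms(3,4)] by (simp add: diag_mat_add add.assoc)
  also have "\<dots> = R g ** ?A ** R (g + d) + R g ** diag_mat d ** R (g + d)"
    by (simp only: matrix_add_ldistrib matrix_add_rdistrib matrix_mul_assoc)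
  finally show ?thesis
    using R_left[OF assms(1,2)] by (simp add: algebra_simps)
qed

lemma add_nonneg_neq_zero:
  fixes g d :: "real^'n"
  assumes "0 \<le> g" "g \<noteq> 0" "0 \<le> d"
  shows "0 \<le> g + d" "g + d \<noteq> 0"
  using assms by (auto simp: less_eq_vec_def vec_eq_iff add_nonneg_eq_0_iff)

lemma R_antimono:
  assumes "0 \<le> g" "g \<noteq> 0" "g \<le> h"
  shows "R h \<le> R g"
proof -
  define d where "d = h - g"
  have d: "0 \<le> d" and h: "h = g + d"
    using assms by (auto simp: d_def less_eq_vec_def)
  note gd = add_nonneg_neq_zero[OF assms(1,2) d]
  have "0 \<le> R g ** diag_mat d ** R (g + d)"
    by (intro matrix_mult_nonneg R_nonneg diag_mat_nonneg assms d gd)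
  then show ?thesis
    unfolding R_diff[OF assms(1,2) gd, symmetric] h by (simp add: less_eq_vec_def)
qed

lemma R_supermodular:
  assumes g: "0 \<le> g" "g \<noteq> 0" and "g \<le> h" and d: "0 \<le> d"
  shows "R h - R (h + d) \<le> R g - R (g + d)"
proof -
  have h: "0 \<le> h" "h \<noteq> 0"
    using add_nonneg_neq_zero[OF g, of "h - g"] \<open>g \<le> h\<close> by (auto simp: less_eq_vec_def)
  note gd = add_nonneg_neq_zero[OF g d] and hd = add_nonneg_neq_zero[OF h d]
  have "g + d \<le> h + d"
    using \<open>g \<le> h\<close> by (simp add: less_eq_vec_def)
  \<comment> \<open>The increment \<open>d\<close> is common to both sides, so only the outer
    factors change, and both decrease from \<open>g\<close> to \<open>h\<close>.\<close>
  then have "R h ** diag_mat d ** R (h + d) \<le> R g ** diag_mat d ** R (g + d)"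
    by (intro matrix_mult_mono matrix_mult_nonneg R_antimono R_nonneg diag_mat_nonneg
        order_refl g h gd hd d \<open>g \<le> h\<close>)
  then show ?thesis
    using g h gd hd by (simp add: R_diff)
qed

end

section \<open>Truncated trust levels and limits along \<open>approach\<close>\<close>

text \<open>A path through \<open>approach a\<close> with a single real parameter. The case
  distinction matters because \<open>enn2real\<close> sends \<infinity> to 0.\<close>

definition truncate :: "ennreal^'n \<Rightarrow> real \<Rightarrow> real^'n" where
  "truncate a t = (\<chi> i. if a $ i = \<infinity> then t else enn2real (a $ i))"

lemma truncate_nonneg: "0 \<le> t \<Longrightarrow> 0 \<le> truncate a t"
  by (simp add: truncate_def less_eq_vec_def)

lemma truncate_pos: "0 < t \<Longrightarrow> 0 < a $ i \<Longrightarrow> 0 < truncate a t $ i"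
  by (auto simp: truncate_def enn2real_positive_iff less_top[symmetric])

lemma truncate_restrict_to:
  "truncate (restrict_to a S) t = (\<chi> i. if i \<in> S then truncate a t $ i else 0)"
  by (simp add: truncate_def restrict_to_def vec_eq_iff)

lemma filterlim_truncate: "filterlim (truncate a) (approach a) at_top"
  unfolding approach_def filterlim_INF truncate_def
  by (auto simp: filterlim_filtercomap_iff o_def filterlim_principal filterlim_ident)

text \<open>Infinite coordinates eventually pass any bound and finite ones are pinned to their
  value; as there are finitely many, the coordinates can be combined.\<close>

lemma eventually_approach_ge:
  assumes "\<And>i. a $ i \<noteq> \<infinity> \<Longrightarrow> h $ i = enn2real (a $ i)"
  shows "\<forall>\<^sub>F g in approach a. h \<le> g"
proof -
  have "\<forall>\<^sub>F g in approach a. h $ i \<le> g $ i" for i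
    unfolding approach_def
    by (rule eventually_INF1[of i])
      (use assms in \<open>auto simp: eventually_principal
        intro: eventually_filtercomapI eventually_ge_at_top\<close>)
  then show ?thesis
    by (simp add: less_eq_vec_def eventually_all_finite)
qed

lemma eventually_approach_finite: "\<forall>\<^sub>F g in approach a. \<forall>i. a $ i \<noteq> \<infinity> \<longrightarrow> g $ i = enn2real (a $ i)"
proof -
  have "\<forall>\<^sub>F g in approach a. a $ i \<noteq> \<infinity> \<longrightarrow> g $ i = enn2real (a $ i)" for i
    unfolding approach_def
    by (rule eventually_INF1[of i]) (auto simp: eventually_principal)
  then show ?thesis
    by (simp add: eventually_all_finite)
qed

text \<open>The analogue of convergence of bounded monotone sequences: the limit is an infimum of
  values. The truncation at 1 only fixes a starting point above which \<open>f\<close> is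
  controlled.\<close>

lemma antimono_tendsto_approach:
  fixes f :: "real^'n \<Rightarrow> real"
  assumes anti: "\<And>x y. truncate a 1 \<le> x \<Longrightarrow> x \<le> y \<Longrightarrow> f y \<le> f x"
    and bdd: "\<And>x. truncate a 1 \<le> x \<Longrightarrow> b \<le> f x"
  shows "\<exists>l. (f \<longlongrightarrow> l) (approach a)"
proof
  \<comment> \<open>The infimum is taken over vectors with the prescribed finite entries, so that
    \<open>approach a\<close> eventually stays in \<open>D\<close> and eventually dominates each of
    its members.\<close>
  define D where "D = {g. truncate a 1 \<le> g \<and> (\<forall>i. a $ i \<noteq> \<infinity> \<longrightarrow> g $ i = enn2real (a $ i))}"
  have D0: "truncate a 1 \<in> D"
    by (simp add: D_def truncate_def)
  have bdd: "bdd_below (f ` D)"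
    using bdd by (auto simp: D_def intro!: bdd_belowI)
  have evD: "\<forall>\<^sub>F g in approach a. g \<in> D"
    using eventually_approach_ge[of a "truncate a 1"] eventually_approach_finite[of a]
    by (auto simp: D_def truncate_def elim: eventually_elim2)
  show "(f \<longlongrightarrow> (INF g\<in>D. f g)) (approach a)"
  proof (rule order_tendstoI)
    fix y assume "y < (INF g\<in>D. f g)"
    with evD show "\<forall>\<^sub>F g in approach a. y < f g"
      by (auto elim!: eventually_mono intro: less_le_trans cINF_lower[OF bdd])
  next
    fix y assume "(INF g\<in>D. f g) < y"
    then obtain h where h: "h \<in> D" "f h < y"
      using D0 bdd by (subst (asm) cINF_less_iff) auto
    \<comment> \<open>Once \<open>g\<close> exceeds \<open>h\<close> in every entry, antitonicity
      gives \<open>f g \<le> f h < y\<close>.\<close>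
    have "\<forall>\<^sub>F g in approach a. h \<le> g"
      using h by (intro eventually_approach_ge) (auto simp: D_def)
    then show "\<forall>\<^sub>F g in approach a. f g < y"
      by (rule eventually_mono) (use h anti in \<open>auto simp: D_def intro: le_less_trans\<close>)
  qed
qed

section \<open>The extended inverse: existence, sign, monotonicity and supermodularity\<close>

context irreducible_nonneg
begin

text \<open>Guarantees that \<beta> plus any truncation of \<open>a\<close> at a positive level is
  nonnegative and nonzero. The disjunction treats \<beta> \<noteq> 0 and \<beta> = 0
  together.\<close>

definition grounded :: "real^'n \<Rightarrow> ennreal^'n \<Rightarrow> bool" where
  "grounded \<beta> a \<longleftrightarrow> 0 \<le> \<beta> \<and> (\<exists>i. 0 < \<beta> $ i \<or> 0 < a $ i)"

lemma grounded_truncate: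
  assumes "grounded \<beta> a" "0 < t"
  shows "0 \<le> \<beta> + truncate a t" "\<beta> + truncate a t \<noteq> 0"
proof -
  have b: "0 \<le> \<beta> $ i" and c: "0 \<le> truncate a t $ i" for i
    using assms truncate_nonneg[of t a] by (auto simp: grounded_def less_eq_vec_def)
  show "0 \<le> \<beta> + truncate a t"
    using b c by (simp add: less_eq_vec_def)
  obtain i where "0 < \<beta> $ i \<or> 0 < truncate a t $ i"
    using assms truncate_pos by (auto simp: grounded_def)
  then have "0 < (\<beta> + truncate a t) $ i"
    using b[of i] c[of i] by auto
  then show "\<beta> + truncate a t \<noteq> 0"
    by (metis less_irrefl zero_index)
qed

text \<open>Each entry of \<open>R (\<beta> + g)\<close> is antitone in \<open>g\<close> and bounded
  below by 0, hence converges; entrywise limits assemble to a matrix limit.\<close>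

lemma ext_inv_exists:
  assumes "grounded \<beta> a"
  shows "ext_inv_exists (laplacian W + diag_mat \<beta>) a"
proof -
  let ?F = "\<lambda>g. matrix_inv (laplacian W + diag_mat \<beta> + diag_mat g)"
  have F: "?F g = R (\<beta> + g)" for g
    by (simp add: R_def diag_mat_add add.assoc)
  \<comment> \<open>Such a \<open>g\<close> arises from the truncation at 1 by adding a nonnegative
    vector, which keeps the diagonal nonnegative and nonzero.\<close>
  have dom: "0 \<le> \<beta> + g" "\<beta> + g \<noteq> 0" if "truncate a 1 \<le> g" for g
    using add_nonneg_neq_zero[OF grounded_truncate[OF assms zero_less_one], of "g - truncate a 1"]
      that by (auto simp: less_eq_vec_def)
  have "\<exists>l. ((\<lambda>g. ?F g $ i $ j) \<longlongrightarrow> l) (approach a)" for i j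
  proof (rule antimono_tendsto_approach[where b = 0])
    fix x y :: "real^'n" assume x: "truncate a 1 \<le> x"
    show "0 \<le> ?F x $ i $ j"
      using R_nonneg[OF dom[OF x]] unfolding F by (simp add: less_eq_vec_def)
    assume "x \<le> y"
    then have "\<beta> + x \<le> \<beta> + y"
      by (simp add: less_eq_vec_def)
    then show "?F y $ i $ j \<le> ?F x $ i $ j"
      using R_antimono[OF dom[OF x]] unfolding F by (simp add: less_eq_vec_def)
  qed
  then obtain l where l: "((\<lambda>g. ?F g $ i $ j) \<longlongrightarrow> l i j) (approach a)" for i j
    by metis
  then have lim: "(?F \<longlongrightarrow> (\<chi> i j. l i j)) (approach a)"
    by (intro vec_tendstoI) simp
  then have "ext_inv (laplacian W + diag_mat \<beta>) a = (\<chi> i j. l i j)"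
    unfolding ext_inv_def by (rule tendsto_Lim[OF approach_neq_bot])
  moreover have "\<forall>\<^sub>F g in approach a. truncate a 1 \<le> g"
    by (rule eventually_approach_ge) (simp add: truncate_def)
  then have "\<forall>\<^sub>F g in approach a. invertible (laplacian W + diag_mat \<beta> + diag_mat g)"
    by (rule eventually_mono)
      (use invertible_laplacian_add[OF dom] in \<open>simp add: diag_mat_add add.assoc\<close>)
  ultimately show ?thesis
    using lim by (simp add: ext_inv_exists_def)
qed

text \<open>Different sets have different filters \<open>approach\<close>; the truncation level is
  one parameter shared by all of them, along which their inverses can be compared before passing to
  the limit.\<close>

lemma R_truncate_tendsto:
  assumes "grounded \<beta> a"
  shows "((\<lambda>t. R (\<beta> + truncate a t) $ i $ j) \<longlongrightarrow> ext_inv (laplacian W + diag_mat \<beta>) a $ i $ j) at_top"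
proof -
  have "((\<lambda>t. R (\<beta> + truncate a t)) \<longlongrightarrow> ext_inv (laplacian W + diag_mat \<beta>) a) at_top"
    using filterlim_compose[OF _ filterlim_truncate] ext_inv_exists[OF assms]
    by (auto simp: ext_inv_exists_def R_def diag_mat_add add.assoc)
  then show ?thesis
    by (intro tendsto_vec_nth)
qed

lemma ext_inv_nonneg:
  assumes "grounded \<beta> a"
  shows "0 \<le> ext_inv (laplacian W + diag_mat \<beta>) a"
proof -
  have "\<forall>\<^sub>F t in at_top. 0 \<le> R (\<beta> + truncate a t) $ i $ j" for i j
    using eventually_gt_at_top[of 0]
    by eventually_elim (use R_nonneg[OF grounded_truncate[OF assms]] in \<open>simp add: less_eq_vec_def\<close>)
  then show ?thesis
    using tendsto_lowerbound[OF R_truncate_tendsto[OF assms]] by (simp add: less_eq_vec_def)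
qed

lemma grounded_mono:
  assumes "grounded \<beta> (restrict_to \<alpha> S)" "S \<subseteq> T"
  shows "grounded \<beta> (restrict_to \<alpha> T)"
  using assms by (fastforce simp: grounded_def restrict_to_def split: if_splits)

lemma truncate_restrict_mono:
  assumes "S \<subseteq> T" "0 < t"
  shows "\<beta> + truncate (restrict_to \<alpha> S) t \<le> \<beta> + truncate (restrict_to \<alpha> T) t"
  using assms truncate_nonneg[of t \<alpha>] by (auto simp: less_eq_vec_def truncate_restrict_to)

lemma ext_inv_antimono:
  assumes S: "grounded \<beta> (restrict_to \<alpha> S)" and "S \<subseteq> T"
  shows "ext_inv (laplacian W + diag_mat \<beta>) (restrict_to \<alpha> T)
    \<le> ext_inv (laplacian W + diag_mat \<beta>) (restrict_to \<alpha> S)"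
proof -
  let ?R = "\<lambda>S t. R (\<beta> + truncate (restrict_to \<alpha> S) t)"
  have "\<forall>\<^sub>F t in at_top. ?R T t $ i $ j \<le> ?R S t $ i $ j" for i j
    using eventually_gt_at_top[of 0]
    by eventually_elim
      (use R_antimono[OF grounded_truncate[OF S] truncate_restrict_mono[OF \<open>S \<subseteq> T\<close>]] in
        \<open>simp add: less_eq_vec_def\<close>)
  then show ?thesis
    using tendsto_le[OF _ R_truncate_tendsto[OF S] R_truncate_tendsto[OF grounded_mono[OF assms]]]
    by (simp add: less_eq_vec_def)
qed

text \<open>At every positive truncation level this is \<open>R_supermodular\<close> with an
  increment supported at \<open>v\<close>; the inequality survives the limit.\<close>

lemma ext_inv_supermodular:
  assumes S: "grounded \<beta> (restrict_to \<alpha> S)" and "S \<subseteq> T" "v \<notin> T"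
  shows "ext_inv (laplacian W + diag_mat \<beta>) (restrict_to \<alpha> T)
      - ext_inv (laplacian W + diag_mat \<beta>) (restrict_to \<alpha> (insert v T))
    \<le> ext_inv (laplacian W + diag_mat \<beta>) (restrict_to \<alpha> S)
      - ext_inv (laplacian W + diag_mat \<beta>) (restrict_to \<alpha> (insert v S))"
proof -
  let ?R = "\<lambda>S t. R (\<beta> + truncate (restrict_to \<alpha> S) t)"
  let ?d = "\<lambda>t. truncate (restrict_to \<alpha> {v}) t"
  \<comment> \<open>Because \<open>v\<close> lies outside the set, adding it adds the same vector
    \<open>?d t\<close> whether the set is \<open>S\<close> or \<open>T\<close>.\<close>
  have ins: "\<beta> + truncate (restrict_to \<alpha> (insert v A)) t = \<beta> + truncate (restrict_to \<alpha> A) t + ?d t"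
    if "v \<notin> A" for A t
    using that by (auto simp: truncate_restrict_to vec_eq_iff)
  have le: "?R T t - ?R (insert v T) t \<le> ?R S t - ?R (insert v S) t" if "0 < t" for t
  proof -
    have "v \<notin> S" using assms by auto
    show ?thesis
      unfolding ins[OF \<open>v \<notin> S\<close>] ins[OF \<open>v \<notin> T\<close>] using that
      by (intro R_supermodular grounded_truncate[OF S] truncate_restrict_mono[OF \<open>S \<subseteq> T\<close>]
          truncate_nonneg) auto
  qed
  have ev: "\<forall>\<^sub>F t in at_top. ?R T t $ i $ j - ?R (insert v T) t $ i $ j
      \<le> ?R S t $ i $ j - ?R (insert v S) t $ i $ j" for i j
    using eventually_gt_at_top[of 0]
    by eventually_elim (use le in \<open>simp add: less_eq_vec_def\<close>)
  have lim: "((\<lambda>t. ?R A t $ i $ j - ?R (insert v A) t $ i $ j) \<longlongrightarrow>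
      ext_inv (laplacian W + diag_mat \<beta>) (restrict_to \<alpha> A) $ i $ j
      - ext_inv (laplacian W + diag_mat \<beta>) (restrict_to \<alpha> (insert v A)) $ i $ j) at_top"
    if "S \<subseteq> A" for A i j
    by (intro tendsto_diff R_truncate_tendsto grounded_mono[OF S]) (use that in auto)
  show ?thesis
    using tendsto_le[OF _ lim[OF order_refl] lim[OF \<open>S \<subseteq> T\<close>] ev]
    by (simp add: less_eq_vec_def)
qed

end

section \<open>Both cases of the statement, read off from grounded diagonals\<close>

theorem lemma3:
  fixes E :: "('n::finite \<times> 'n) set"
    and W :: "real^'n^'n"
    and \<alpha> :: "ennreal^'n"
  assumes "strongly_connected E"
    and "\<And>i j. W $ i $ j \<ge> 0"
    and "\<And>i j. i \<noteq> j \<Longrightarrow> (i, j) \<in> E \<Longrightarrow> W $ i $ j > 0"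
    and "\<And>i j. i \<noteq> j \<Longrightarrow> (i, j) \<notin> E \<Longrightarrow> W $ i $ j = 0"
    and "\<exists>i. W $ i $ i > 0"
  shows
    "(\<forall>\<beta> :: real^'n. (\<forall>i. \<beta> $ i \<ge> 0) \<and> \<beta> \<noteq> 0 \<longrightarrow>
        (\<forall>S. ext_inv_exists (L\<beta> W \<beta>) (restrict_to \<alpha> S) \<and> inv\<beta> W \<beta> \<alpha> S \<ge> 0) \<and>
        (\<forall>S T. S \<subseteq> T \<longrightarrow> inv\<beta> W \<beta> \<alpha> T \<le> inv\<beta> W \<beta> \<alpha> S) \<and>
        (\<forall>S v k. v \<notin> S \<and> k \<notin> S \<longrightarrow>
           inv\<beta> W \<beta> \<alpha> S - inv\<beta> W \<beta> \<alpha> (S \<union> {v})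
             \<ge> inv\<beta> W \<beta> \<alpha> (S \<union> {k}) - inv\<beta> W \<beta> \<alpha> (S \<union> {k, v}) \<and>
           inv\<beta> W \<beta> \<alpha> (S \<union> {k}) - inv\<beta> W \<beta> \<alpha> (S \<union> {k, v}) \<ge> 0)) \<and>
     (\<forall>S. S \<noteq> {} \<and> admissible0 \<alpha> S \<longrightarrow> ext_inv_exists (laplacian W) (restrict_to \<alpha> S)) \<and>
     (\<forall>S. admissible0 \<alpha> S \<longrightarrow> inv0 W \<alpha> S \<ge> 0) \<and>
     (\<forall>S T. S \<subseteq> T \<and> admissible0 \<alpha> S \<and> admissible0 \<alpha> T \<longrightarrow> inv0 W \<alpha> T \<le> inv0 W \<alpha> S) \<and>
     (\<forall>S v k. v \<notin> S \<and> k \<notin> S \<and>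
        admissible0 \<alpha> S \<and> admissible0 \<alpha> (S \<union> {v}) \<and>
        admissible0 \<alpha> (S \<union> {k}) \<and> admissible0 \<alpha> (S \<union> {k, v}) \<longrightarrow>
        inv0 W \<alpha> S - inv0 W \<alpha> (S \<union> {v}) \<ge> inv0 W \<alpha> (S \<union> {k}) - inv0 W \<alpha> (S \<union> {k, v}) \<and>
        inv0 W \<alpha> (S \<union> {k}) - inv0 W \<alpha> (S \<union> {k, v}) \<ge> 0)"
proof -
  \<comment> \<open>A loop of \<open>E\<close> need not carry positive weight; the reflexive part of
    the closure covers it.\<close>
  have "(i, j) \<in> {(i, j). W $ i $ j > 0}\<^sup>*" if "(i, j) \<in> E" for i j
    using assms(3)[of i j] that by (cases "i = j") auto
  then have "E\<^sup>* \<subseteq> {(i, j). W $ i $ j > 0}\<^sup>*"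
    by (intro rtrancl_subset_rtrancl) auto
  then interpret irreducible_nonneg W
    by unfold_locales (use assms(1,2) in \<open>auto simp: strongly_connected_def\<close>)
  have sub: "S \<subseteq> S \<union> {k}" "S \<union> {k} \<subseteq> S \<union> {k, v}" for S and k v :: 'n
    by auto
  have supermodular: "ext_inv (laplacian W + diag_mat \<beta>) (restrict_to \<alpha> (S \<union> {k}))
      - ext_inv (laplacian W + diag_mat \<beta>) (restrict_to \<alpha> (S \<union> {k, v}))
    \<le> ext_inv (laplacian W + diag_mat \<beta>) (restrict_to \<alpha> S)
      - ext_inv (laplacian W + diag_mat \<beta>) (restrict_to \<alpha> (S \<union> {v}))"
    if S: "grounded \<beta> (restrict_to \<alpha> S)" and v: "v \<notin> S" for \<beta> S v k
  \<comment> \<open>For \<open>v = k\<close> the difference at \<open>S \<union> {k}\<close> is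
    zero, and the claim reduces to monotonicity.\<close>
  proof (cases "v = k")
    case True
    then show ?thesis
      using ext_inv_antimono[OF S sub(1)] by (simp add: less_eq_vec_def)
  next
    case False
    have "S \<union> {k, v} = insert v (S \<union> {k})" "S \<union> {v} = insert v S"
      by auto
    then show ?thesis
      using ext_inv_supermodular[OF S sub(1)[where k = k], of v] False v by simp
  qed
  have \<beta>: "grounded \<beta> a" if "\<forall>i. \<beta> $ i \<ge> 0" "\<beta> \<noteq> 0" for \<beta> :: "real^'n" and a
    using that by (auto simp: grounded_def less_eq_vec_def vec_eq_iff order_less_le)
  \<comment> \<open>Admissibility puts an index of positive trust into \<open>S\<close>, which
    grounds the Laplacian without \<beta>.\<close>
  have 0: "grounded 0 (restrict_to \<alpha> S)" if "S \<noteq> {}" "admissible0 \<alpha> S" for S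
    using that by (auto simp: grounded_def admissible0_def trusting_def restrict_to_def)
  show ?thesis
    unfolding inv\<beta>_def L\<beta>_def
  proof (intro conjI allI impI; (elim conjE)?)
    fix \<beta> :: "real^'n" and S
    assume b: "\<forall>i. \<beta> $ i \<ge> 0" "\<beta> \<noteq> 0"
    let ?X = "\<lambda>S. ext_inv (laplacian W + diag_mat \<beta>) (restrict_to \<alpha> S)"
    show "ext_inv_exists (laplacian W + diag_mat \<beta>) (restrict_to \<alpha> S)"
      by (rule ext_inv_exists[OF \<beta>[OF b]])
    show "0 \<le> ?X S"
      by (rule ext_inv_nonneg[OF \<beta>[OF b]])
    show "?X T \<le> ?X S" if "S \<subseteq> T" for T
      by (rule ext_inv_antimono[OF \<beta>[OF b] that])
    fix v k assume "v \<notin> S"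
    then show "?X (S \<union> {k}) - ?X (S \<union> {k, v}) \<le> ?X S - ?X (S \<union> {v})"
      by (rule supermodular[OF \<beta>[OF b]])
    show "0 \<le> ?X (S \<union> {k}) - ?X (S \<union> {k, v})"
      using ext_inv_antimono[OF \<beta>[OF b] sub(2)] by (simp add: less_eq_vec_def)
  next
    fix S assume "S \<noteq> {}" "admissible0 \<alpha> S"
    then show "ext_inv_exists (laplacian W) (restrict_to \<alpha> S)"
      using ext_inv_exists[OF 0] by simp
  next
    fix S assume "admissible0 \<alpha> S"
    then show "0 \<le> inv0 W \<alpha> S"
      using ext_inv_nonneg[OF 0[of S]] by (simp add: inv0_def less_eq_vec_def)
  next
    \<comment> \<open>For \<open>S = {}\<close> the upper bound is \<infinity>; otherwise
      \<open>T\<close> is nonempty too and reals are compared.\<close>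
    fix S T assume "S \<subseteq> T" "admissible0 \<alpha> S"
    then show "inv0 W \<alpha> T \<le> inv0 W \<alpha> S"
      using ext_inv_antimono[OF 0[of S], of T] by (auto simp: inv0_def less_eq_vec_def)
  next
    fix S v k
    assume v: "v \<notin> S" and adm: "admissible0 \<alpha> S" "admissible0 \<alpha> (S \<union> {k})"
    \<comment> \<open>For \<open>S = {}\<close> the upper bound is \<infinity> minus a real, hence
      \<infinity>.\<close>
    show "inv0 W \<alpha> (S \<union> {k}) - inv0 W \<alpha> (S \<union> {k, v}) \<le> inv0 W \<alpha> S - inv0 W \<alpha> (S \<union> {v})"
      using supermodular[OF 0[OF _ adm(1)] v, of k]
      by (cases "S = {}") (simp_all add: inv0_def less_eq_vec_def)
    \<comment> \<open>\<open>S \<union> {k}\<close> is nonempty, so both terms are real even for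
      empty \<open>S\<close>.\<close>
    show "0 \<le> inv0 W \<alpha> (S \<union> {k}) - inv0 W \<alpha> (S \<union> {k, v})"
      using ext_inv_antimono[OF 0[OF _ adm(2)] sub(2), of v]
      by (simp add: inv0_def less_eq_vec_def)
  qed
qed

end
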